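(* Let $(G_2)^{\gamma}=\{\alpha\in G_2 \mid \gamma\alpha\gamma=\alpha\}$ and $(G_2)^{\gamma_H}=\{\alpha\in G_2\mid \gamma_H\alpha\gamma_H=\alpha\}$. Then $$(G_2)^{\gamma}\cap (G_2)^{\gamma_H}\;\cong\;\big((U(1)\times U(1))/\mathbf{Z}_2\big)\rtimes \mathcal{Z}_2,$$ where $\mathbf{Z}_2=\{(1,1),(-1,-1)\}$ and $\mathcal{Z}_2=\{1,\gamma_C\}$ is the group of order $2$ generated by $\gamma_C$, acting through $\gamma_C(a,b)=(\overline{a},\overline{b})$.
   Context: Let $\mathbf{H}$ be the quaternions with basis $1,e_1,e_2,e_3=e_1e_2$, let $\mathbf{C}=\mathbf{R}\oplus\mathbf{R}e_1\subset\mathbf{H}$, so $\mathbf{H}=\mathbf{C}\oplus\mathbf{C}e_2$, and let $\mathfrak{C}=\mathbf{H}\oplus\mathbf{H}e_4$ be the division Cayley algebra with product $(m+ae_4)(n+be_4)=(mn-\overline{b}a)+(a\overline{n}+bm)e_4$. The compact group $G_2$ is $\{\alpha\in \mathrm{Iso}_{\mathbf R}(\mathfrak{C})\mid \alpha(xy)=(\alpha x)(\alpha y)\}$, where $\mathrm{Iso}_{\mathbf R}$ denotes $\mathbf{R}$-linear isomorphisms. Involutive elements of $G_2$: $\gamma(x+ye_4)=x-ye_4$ for $x,y\in\mathbf{H}$. On $\mathbf{H}$ put $\gamma_H(a+be_2)=a-be_2$ and $\gamma_C(a+be_2)=\overline{a}+\overline{b}e_2$ ($a,b\in\mathbf{C}$),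 and extend to $\mathfrak{C}$ by $\gamma_H(x+ye_4)=\gamma_Hx+(\gamma_Hy)e_4$, $\gamma_C(x+ye_4)=\gamma_Cx+(\gamma_Cy)e_4$. $U(1)=\{a\in\mathbf{C}\mid a\overline a=1\}$. The action of $\mathcal{Z}_2$ on $U(1)\times U(1)$ induces the action on the quotient used in the semidirect product. *)

theory Defs
  imports "HOL-Analysis.Analysis" "HOL-Algebra.Coset"
begin

section \<open>Quaternions and the division Cayley algebra\<close>

text \<open>
  The field \<open>\<real> \<oplus> \<real>e\<^sub>1\<close> is the type \<^typ>\<open>complex\<close>, with \<open>e\<^sub>1\<close> as imaginary unit.
  A pair \<open>(a, b)\<close> of complex numbers stands for the quaternion \<open>a + b e\<^sub>2\<close>, and a pair
  \<open>(m, a)\<close> of quaternions for the Cayley number \<open>m + a e\<^sub>4\<close>.  The real vector space structure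
  and the topology are those of the product types.
\<close>

type_synonym quat = "complex \<times> complex"
type_synonym cayley = "quat \<times> quat"

text \<open>The product is determined by bilinearity, associativity, \<open>e\<^sub>2 c = cnj c e\<^sub>2\<close> and
  \<open>e\<^sub>2 e\<^sub>2 = -1\<close>.\<close>

definition qmult :: "quat \<Rightarrow> quat \<Rightarrow> quat" (infixl \<open>\<cdot>\<^sub>H\<close> 70) where
  "x \<cdot>\<^sub>H y = (fst x * fst y - snd x * cnj (snd y), fst x * snd y + snd x * cnj (fst y))"

definition qcnj :: "quat \<Rightarrow> quat" where
  "qcnj x = (cnj (fst x), - snd x)"

definition cmult :: "cayley \<Rightarrow> cayley \<Rightarrow> cayley" (infixl \<open>\<cdot>\<^sub>O\<close> 70) where
  "x \<cdot>\<^sub>O y = (fst x \<cdot>\<^sub>H fst y - qcnj (snd y) \<cdot>\<^sub>H snd x, snd x \<cdot>\<^sub>H qcnj (fst y) + snd y \<cdot>\<^sub>H fst x)"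

lemma qmult_bilinear: "bilinear (\<cdot>\<^sub>H)"
  unfolding bilinear_def
  by (auto intro!: linearI simp: qmult_def prod_eq_iff algebra_simps)

lemma qmult_assoc: "(x \<cdot>\<^sub>H y) \<cdot>\<^sub>H z = x \<cdot>\<^sub>H (y \<cdot>\<^sub>H z)"
  by (simp add: qmult_def prod_eq_iff algebra_simps)

lemma quat_basis_products:
  defines "o1 \<equiv> (1, 0)" and "e1 \<equiv> (\<i>, 0)" and "e2 \<equiv> (0, 1)" and "e3 \<equiv> (0, \<i>)"
  shows "o1 \<cdot>\<^sub>H x = x" "x \<cdot>\<^sub>H o1 = x"
    and "e1 \<cdot>\<^sub>H e1 = - o1" "e2 \<cdot>\<^sub>H e2 = - o1" "e3 \<cdot>\<^sub>H e3 = - o1"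
    and "e1 \<cdot>\<^sub>H e2 = e3" "e2 \<cdot>\<^sub>H e3 = e1" "e3 \<cdot>\<^sub>H e1 = e2"
    and "e2 \<cdot>\<^sub>H e1 = - e3" "e3 \<cdot>\<^sub>H e2 = - e1" "e1 \<cdot>\<^sub>H e3 = - e2"
    and "qcnj o1 = o1" "qcnj e1 = - e1" "qcnj e2 = - e2" "qcnj e3 = - e3"
  by (simp_all add: assms qmult_def qcnj_def prod_eq_iff)


section \<open>The group \<open>G\<^sub>2\<close> and its subgroups\<close>

definition G2 :: "(cayley \<Rightarrow> cayley) monoid" where
  "G2 = \<lparr>carrier = {\<alpha>. linear \<alpha> \<and> bij \<alpha> \<and> (\<forall>x y. \<alpha> (x \<cdot>\<^sub>O y) = \<alpha> x \<cdot>\<^sub>O \<alpha> y)},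
         mult = (\<circ>), one = id\<rparr>"

definition gamma :: "cayley \<Rightarrow> cayley" where
  "gamma x = (fst x, - snd x)"

definition qgammaH :: "quat \<Rightarrow> quat" where
  "qgammaH x = (fst x, - snd x)"

definition qgammaC :: "quat \<Rightarrow> quat" where
  "qgammaC x = (cnj (fst x), cnj (snd x))"

definition gammaH :: "cayley \<Rightarrow> cayley" where
  "gammaH x = (qgammaH (fst x), qgammaH (snd x))"

definition gammaC :: "cayley \<Rightarrow> cayley" where
  "gammaC x = (qgammaC (fst x), qgammaC (snd x))"

definition G2_fix :: "(cayley \<Rightarrow> cayley) \<Rightarrow> (cayley \<Rightarrow> cayley) set" where
  "G2_fix \<sigma> = {\<alpha> \<in> carrier G2. \<sigma> \<circ> \<alpha> \<circ> \<sigma> = \<alpha>}"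

definition G2_gamma_gammaH :: "(cayley \<Rightarrow> cayley) monoid" where
  "G2_gamma_gammaH = G2\<lparr>carrier := G2_fix gamma \<inter> G2_fix gammaH\<rparr>"

text \<open>The product topology on \<^typ>\<open>cayley \<Rightarrow> cayley\<close>, i.e. that of pointwise convergence; on linear
  endomorphisms it is the usual topology of \<open>8 \<times> 8\<close> matrices.\<close>

definition G2_gamma_gammaH_topology :: "(cayley \<Rightarrow> cayley) topology" where
  "G2_gamma_gammaH_topology = top_of_set (carrier G2_gamma_gammaH)"

lemma group_G2: "group G2"
proof (rule groupI)
  fix \<alpha> assume \<alpha>: "\<alpha> \<in> carrier G2"
  then have b: "bij \<alpha>" by (simp add: G2_def)
  have "inv_into UNIV \<alpha> (x \<cdot>\<^sub>O y) = inv_into UNIV \<alpha> x \<cdot>\<^sub>O inv_into UNIV \<alpha> y" for x y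
    using \<alpha> b unfolding G2_def
    by (simp add: inv_f_eq bij_is_inj bij_is_surj surj_f_inv_f del: split_paired_All)
  moreover have "linear (inv_into UNIV \<alpha>)"
    using \<alpha> b by (simp add: G2_def inj_linear_imp_inv_linear bij_is_inj del: split_paired_All)
  ultimately have "inv_into UNIV \<alpha> \<in> carrier G2"
    using b by (simp add: G2_def bij_imp_bij_inv)
  moreover have "inv_into UNIV \<alpha> \<otimes>\<^bsub>G2\<^esub> \<alpha> = \<one>\<^bsub>G2\<^esub>"
    using b by (simp add: G2_def bij_is_inj)
  ultimately show "\<exists>\<beta>\<in>carrier G2. \<beta> \<otimes>\<^bsub>G2\<^esub> \<alpha> = \<one>\<^bsub>G2\<^esub>" by blast
qed (auto simp: G2_def comp_assoc bij_comp linear_compose linear_id simp del: split_paired_All)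

lemma involutions_in_G2: "gamma \<in> carrier G2" "gammaH \<in> carrier G2" "gammaC \<in> carrier G2"
proof -
  note d = gamma_def gammaH_def gammaC_def qgammaH_def qgammaC_def
  have "linear gamma" "linear gammaH" "linear gammaC"
    by (auto intro!: linearI simp: d prod_eq_iff)
  moreover have "bij gamma" "bij gammaH" "bij gammaC"
    by (auto intro!: involuntory_imp_bij simp: d)
  ultimately show "gamma \<in> carrier G2" "gammaH \<in> carrier G2" "gammaC \<in> carrier G2"
    by (auto simp: G2_def d cmult_def qmult_def qcnj_def)
qed

lemma involutions_square:
  "gamma \<circ> gamma = id" "gammaH \<circ> gammaH = id" "gammaC \<circ> gammaC = id" "gammaC \<noteq> id"
proof -
  show "gammaC \<noteq> id"
  proof
    assume "gammaC = id"
    then have "gammaC ((\<i>, 0), 0) = ((\<i>, 0), 0)" by simp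
    then show False by (simp add: gammaC_def qgammaC_def)
  qed
qed (auto simp: gamma_def gammaH_def gammaC_def qgammaH_def qgammaC_def fun_eq_iff)

lemma group_G2_gamma_gammaH: "group G2_gamma_gammaH"
proof -
  interpret group G2 by (rule group_G2)
  have fix_subgroup: "subgroup (G2_fix \<sigma>) G2" if s: "\<sigma> \<in> carrier G2" "\<sigma> \<circ> \<sigma> = id" for \<sigma>
  proof -
    have ss: "\<sigma> (\<sigma> x) = x" for x
      using s(2) by (metis comp_apply id_apply)
    have iff: "\<sigma> \<circ> \<alpha> \<circ> \<sigma> = \<alpha> \<longleftrightarrow> \<sigma> \<circ> \<alpha> = \<alpha> \<circ> \<sigma>" for \<alpha>
      by (auto simp: fun_eq_iff) (metis ss)+
    have fix_eq: "G2_fix \<sigma> = {\<alpha> \<in> carrier G2. \<sigma> \<otimes>\<^bsub>G2\<^esub> \<alpha> = \<alpha> \<otimes>\<^bsub>G2\<^esub> \<sigma>}"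
      by (auto simp: G2_fix_def iff) (auto simp: G2_def)
    show ?thesis
    proof (rule subgroupI)
      show "G2_fix \<sigma> \<noteq> {}" using s(1) unfolding fix_eq by blast
      show "inv\<^bsub>G2\<^esub> \<alpha> \<in> G2_fix \<sigma>" if "\<alpha> \<in> G2_fix \<sigma>" for \<alpha>
        using that s(1) unfolding fix_eq
        by (auto simp: inv_solve_left' inv_solve_right' m_assoc)
          (metis inv_closed inv_solve_left m_assoc m_closed inv_solve_right)
      show "\<alpha> \<otimes>\<^bsub>G2\<^esub> \<beta> \<in> G2_fix \<sigma>" if "\<alpha> \<in> G2_fix \<sigma>" "\<beta> \<in> G2_fix \<sigma>" for \<alpha> \<beta>
        using that s(1) unfolding fix_eq by auto (metis m_assoc)
    qed (auto simp: fix_eq)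
  qed
  show ?thesis
    unfolding G2_gamma_gammaH_def
    by (intro subgroup.subgroup_is_group subgroups_Inter_pair fix_subgroup group_G2
        involutions_in_G2 involutions_square)
qed


section \<open>The group \<open>((U(1) \<times> U(1))/\<int>\<^sub>2) \<rtimes> {1, \<gamma>\<^sub>C}\<close>\<close>

definition semidirect ::
    "('a, 'm) monoid_scheme \<Rightarrow> ('b, 'n) monoid_scheme \<Rightarrow> ('b \<Rightarrow> 'a \<Rightarrow> 'a) \<Rightarrow> ('a \<times> 'b) monoid" where
  "semidirect N K \<theta> =
    \<lparr>carrier = carrier N \<times> carrier K,
     mult = (\<lambda>(n, k) (n', k'). (n \<otimes>\<^bsub>N\<^esub> \<theta> k n', k \<otimes>\<^bsub>K\<^esub> k')),
     one = (\<one>\<^bsub>N\<^esub>, \<one>\<^bsub>K\<^esub>)\<rparr>"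

definition U1 :: "complex monoid" where
  "U1 = \<lparr>carrier = {a. a * cnj a = 1}, mult = (*), one = 1\<rparr>"

definition pmZ2 :: "(complex \<times> complex) set" where
  "pmZ2 = {(1, 1), (-1, -1)}"

definition torus_quot :: "(complex \<times> complex) set monoid" where
  "torus_quot = (U1 \<times>\<times> U1) Mod pmZ2"

definition gammaC_group :: "(cayley \<Rightarrow> cayley) monoid" where
  "gammaC_group = G2\<lparr>carrier := {id, gammaC}\<rparr>"

definition torus_act :: "(cayley \<Rightarrow> cayley) \<Rightarrow> complex \<times> complex \<Rightarrow> complex \<times> complex" where
  "torus_act k = (if k = gammaC then (\<lambda>(a, b). (cnj a, cnj b)) else id)"

text \<open>Elements of the quotient are cosets, so the induced action takes images.\<close>

definition torus_quot_act ::
    "(cayley \<Rightarrow> cayley) \<Rightarrow> (complex \<times> complex) set \<Rightarrow> (complex \<times> complex) set" where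
  "torus_quot_act k A = torus_act k ` A"

definition torus_semidirect :: "((complex \<times> complex) set \<times> (cayley \<Rightarrow> cayley)) monoid" where
  "torus_semidirect = semidirect torus_quot gammaC_group torus_quot_act"

definition quotient_topology :: "'a topology \<Rightarrow> ('a \<Rightarrow> 'b) \<Rightarrow> 'b topology" where
  "quotient_topology X q =
    topology (\<lambda>U. U \<subseteq> q ` topspace X \<and> openin X {x \<in> topspace X. q x \<in> U})"

definition torus_quot_topology :: "(complex \<times> complex) set topology" where
  "torus_quot_topology =
    quotient_topology (top_of_set (carrier (U1 \<times>\<times> U1))) (\<lambda>x. pmZ2 #>\<^bsub>U1 \<times>\<times> U1\<^esub> x)"

definition torus_semidirect_topology ::
    "((complex \<times> complex) set \<times> (cayley \<Rightarrow> cayley)) topology" where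
  "torus_semidirect_topology =
    prod_topology torus_quot_topology (discrete_topology (carrier gammaC_group))"

lemma openin_quotient_topology:
  "openin (quotient_topology X q) U \<longleftrightarrow>
    U \<subseteq> q ` topspace X \<and> openin X {x \<in> topspace X. q x \<in> U}"
proof -
  have "istopology (\<lambda>U. U \<subseteq> q ` topspace X \<and> openin X {x \<in> topspace X. q x \<in> U})"
    unfolding istopology_def
  proof (intro conjI allI impI, goal_cases)
    case (2 S T)
    have "{x \<in> topspace X. q x \<in> S \<inter> T} =
        {x \<in> topspace X. q x \<in> S} \<inter> {x \<in> topspace X. q x \<in> T}" by auto
    with 2 show ?case by (simp add: openin_Int)
  next
    case (4 \<K>)
    have "{x \<in> topspace X. q x \<in> \<Union>\<K>} = (\<Union>U\<in>\<K>. {x \<in> topspace X. q x \<in> U})" by auto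
    with 4 show ?case by auto
  qed auto
  then show ?thesis by (simp add: quotient_topology_def)
qed

lemma quotient_map_quotient_topology: "quotient_map X (quotient_topology X q) q"
proof -
  have "openin X {x \<in> topspace X. q x \<in> q ` topspace X}"
    by (metis (mono_tags, lifting) Collect_cong Collect_mem_eq image_eqI openin_topspace)
  then have "topspace (quotient_topology X q) = q ` topspace X"
    by (auto simp: topspace_def[of "quotient_topology X q"] openin_quotient_topology)
  then show ?thesis by (auto simp: quotient_map_def openin_quotient_topology)
qed

lemma group_semidirect:
  assumes N: "group N" and K: "group K"
    and aut: "\<And>k. k \<in> carrier K \<Longrightarrow> \<theta> k \<in> hom N N"
    and one: "\<And>n. n \<in> carrier N \<Longrightarrow> \<theta> \<one>\<^bsub>K\<^esub> n = n"
    and act: "\<And>k k' n. \<lbrakk>k \<in> carrier K; k' \<in> carrier K; n \<in> carrier N\<rbrakk>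
      \<Longrightarrow> \<theta> (k \<otimes>\<^bsub>K\<^esub> k') n = \<theta> k (\<theta> k' n)"
  shows "group (semidirect N K \<theta>)"
proof -
  interpret N: group N by (rule N)
  interpret K: group K by (rule K)
  have cl: "\<theta> k n \<in> carrier N" if "k \<in> carrier K" "n \<in> carrier N" for k n
    using aut[OF that(1)] that(2) by (auto simp: hom_def)
  have mu: "\<theta> k (n \<otimes>\<^bsub>N\<^esub> n') = \<theta> k n \<otimes>\<^bsub>N\<^esub> \<theta> k n'"
    if "k \<in> carrier K" "n \<in> carrier N" "n' \<in> carrier N" for k n n'
    using aut[OF that(1)] that(2,3) by (auto simp: hom_def)
  show ?thesis
  proof (rule groupI)
    fix x assume "x \<in> carrier (semidirect N K \<theta>)"
    then obtain n k where x: "x = (n, k)" "n \<in> carrier N" "k \<in> carrier K"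
      by (auto simp: semidirect_def)
    let ?y = "(\<theta> (inv\<^bsub>K\<^esub> k) (inv\<^bsub>N\<^esub> n), inv\<^bsub>K\<^esub> k)"
    have "\<theta> (inv\<^bsub>K\<^esub> k) (inv\<^bsub>N\<^esub> n) \<otimes>\<^bsub>N\<^esub> \<theta> (inv\<^bsub>K\<^esub> k) n = \<theta> (inv\<^bsub>K\<^esub> k) \<one>\<^bsub>N\<^esub>"
      using x by (simp flip: mu)
    also have "\<dots> = \<one>\<^bsub>N\<^esub>"
      using hom_one[OF aut N N] x by simp
    finally have "?y \<otimes>\<^bsub>semidirect N K \<theta>\<^esub> x = \<one>\<^bsub>semidirect N K \<theta>\<^esub>"
      using x by (simp add: semidirect_def)
    moreover have "?y \<in> carrier (semidirect N K \<theta>)"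
      using x by (simp add: semidirect_def cl)
    ultimately show "\<exists>y\<in>carrier (semidirect N K \<theta>).
        y \<otimes>\<^bsub>semidirect N K \<theta>\<^esub> x = \<one>\<^bsub>semidirect N K \<theta>\<^esub>" by blast
  qed (auto simp: semidirect_def cl mu one act N.m_assoc K.m_assoc)
qed

lemma group_U1: "group U1"
proof (rule groupI)
  fix a assume "a \<in> carrier U1"
  then have "cnj a \<in> carrier U1" "cnj a \<otimes>\<^bsub>U1\<^esub> a = \<one>\<^bsub>U1\<^esub>"
    by (simp_all add: U1_def mult.commute)
  then show "\<exists>b\<in>carrier U1. b \<otimes>\<^bsub>U1\<^esub> a = \<one>\<^bsub>U1\<^esub>" by blast
next
  fix a b assume "a \<in> carrier U1" "b \<in> carrier U1"
  then have "(a * cnj a) * (b * cnj b) = 1" by (simp add: U1_def)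
  then show "a \<otimes>\<^bsub>U1\<^esub> b \<in> carrier U1" by (simp add: U1_def mult_ac)
qed (auto simp: U1_def)

lemma pmZ2_normal: "pmZ2 \<lhd> U1 \<times>\<times> U1"
proof -
  interpret T: group "U1 \<times>\<times> U1" by (intro DirProd_group group_U1)
  have T: "comm_group (U1 \<times>\<times> U1)"
    by (rule T.group_comm_groupI) (auto simp: U1_def mult.commute)
  have "inv\<^bsub>U1 \<times>\<times> U1\<^esub> (-1, -1) = (-1, -1)"
    by (rule T.inv_equality) (auto simp: U1_def)
  moreover have "inv\<^bsub>U1 \<times>\<times> U1\<^esub> (1, 1) = (1, 1)"
    by (rule T.inv_equality) (auto simp: U1_def)
  ultimately have "subgroup pmZ2 (U1 \<times>\<times> U1)"
    by (intro T.subgroupI) (auto simp: pmZ2_def U1_def)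
  then show ?thesis by (rule comm_group.subgroup_imp_normal[OF T])
qed

lemma group_torus_semidirect: "group torus_semidirect"
  unfolding torus_semidirect_def
proof (rule group_semidirect)
  interpret N: normal pmZ2 "U1 \<times>\<times> U1" by (rule pmZ2_normal)
  show "group torus_quot"
    unfolding torus_quot_def by (rule N.factorgroup_is_group)
  show "group gammaC_group"
  proof (rule groupI)
    fix x assume "x \<in> carrier gammaC_group"
    then have "x \<otimes>\<^bsub>gammaC_group\<^esub> x = \<one>\<^bsub>gammaC_group\<^esub>"
      by (auto simp: gammaC_group_def G2_def involutions_square)
    with \<open>x \<in> carrier gammaC_group\<close>
    show "\<exists>y\<in>carrier gammaC_group. y \<otimes>\<^bsub>gammaC_group\<^esub> x = \<one>\<^bsub>gammaC_group\<^esub>" by blast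
  qed (auto simp: gammaC_group_def G2_def involutions_square comp_assoc)
  have act_mult: "torus_act k (x \<otimes>\<^bsub>U1 \<times>\<times> U1\<^esub> y) = torus_act k x \<otimes>\<^bsub>U1 \<times>\<times> U1\<^esub> torus_act k y"
    for k x y
    by (cases x; cases y) (simp add: torus_act_def U1_def)
  have act_cl: "torus_act k x \<in> carrier (U1 \<times>\<times> U1)" if "x \<in> carrier (U1 \<times>\<times> U1)" for k x
    using that by (auto simp: torus_act_def U1_def mult.commute)
  have act_Z2: "torus_act k ` pmZ2 = pmZ2" for k
    by (auto simp: torus_act_def pmZ2_def)
  have act_coset: "torus_quot_act k (pmZ2 #>\<^bsub>U1 \<times>\<times> U1\<^esub> x) = pmZ2 #>\<^bsub>U1 \<times>\<times> U1\<^esub> torus_act k x" for k x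
  proof -
    have "torus_quot_act k (pmZ2 #>\<^bsub>U1 \<times>\<times> U1\<^esub> x) =
        (torus_act k ` pmZ2) #>\<^bsub>U1 \<times>\<times> U1\<^esub> torus_act k x"
      by (simp add: torus_quot_act_def r_coset_def image_UN act_mult)
    then show ?thesis by (simp add: act_Z2)
  qed
  show "torus_quot_act k \<in> hom torus_quot torus_quot" for k
  proof (rule homI)
    fix A assume "A \<in> carrier torus_quot"
    then obtain x where "x \<in> carrier (U1 \<times>\<times> U1)" "A = pmZ2 #>\<^bsub>U1 \<times>\<times> U1\<^esub> x"
      by (auto simp: torus_quot_def FactGroup_def RCOSETS_def)
    then show "torus_quot_act k A \<in> carrier torus_quot"
      using act_cl[of x k] unfolding torus_quot_def FactGroup_def RCOSETS_def
      by (auto simp only: act_coset partial_object.simps)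
  next
    fix A B
    show "torus_quot_act k (A \<otimes>\<^bsub>torus_quot\<^esub> B) = torus_quot_act k A \<otimes>\<^bsub>torus_quot\<^esub> torus_quot_act k B"
      by (simp add: torus_quot_def FactGroup_def set_mult_def torus_quot_act_def image_UN act_mult)
  qed
  have one: "\<one>\<^bsub>gammaC_group\<^esub> = id" by (simp add: gammaC_group_def G2_def)
  have act_id: "torus_act id = id" using involutions_square(4) by (auto simp: torus_act_def)
  show "torus_quot_act \<one>\<^bsub>gammaC_group\<^esub> A = A" for A
    by (simp add: one torus_quot_act_def act_id)
  have act_C: "torus_act gammaC (torus_act gammaC x) = x" for x
    by (simp add: torus_act_def split: prod.split)
  show "torus_quot_act (k \<otimes>\<^bsub>gammaC_group\<^esub> k') A = torus_quot_act k (torus_quot_act k' A)"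
    if "k \<in> carrier gammaC_group" "k' \<in> carrier gammaC_group" for k k' A
    using that
    by (auto simp: gammaC_group_def G2_def torus_quot_act_def act_id act_C image_image
        involutions_square)
qed

lemma topspace_torus_semidirect_topology:
  "topspace torus_semidirect_topology = carrier torus_semidirect"
proof -
  have "topspace torus_quot_topology = carrier torus_quot"
    using quotient_imp_surjective_map[OF quotient_map_quotient_topology[of
        "top_of_set (carrier (U1 \<times>\<times> U1))" "\<lambda>x. pmZ2 #>\<^bsub>U1 \<times>\<times> U1\<^esub> x"]]
    unfolding torus_quot_topology_def torus_quot_def FactGroup_def RCOSETS_def
    by (simp add: UNION_singleton_eq_range del: carrier_DirProd)
  then show ?thesis
    by (simp add: torus_semidirect_topology_def torus_semidirect_def semidirect_def)
qed

end

theory Submission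
  imports Defs
begin

text \<open>
  The joint eigenspaces of \<open>\<gamma>\<close> and \<open>\<gamma>\<^sub>H\<close> are \<open>\<complex>\<close>, \<open>\<complex>e\<^sub>2\<close>, \<open>\<complex>e\<^sub>4\<close> and \<open>\<complex>e\<^sub>2e\<^sub>4\<close>.
  An automorphism preserving them is the identity or conjugation on \<open>\<complex>\<close>, and after composition with
  a power of \<open>\<gamma>\<^sub>C\<close> it multiplies the four lines by \<open>1, p, q, pq\<close>, where \<open>p\<close> and \<open>q\<close> are the unit
  coefficients of the images of \<open>e\<^sub>2\<close> and \<open>e\<^sub>4\<close>.  The substitution \<open>p = ab\<close>, \<open>q = a b\<^sup>-\<^sup>1\<close> is a double
  covering of the torus by itself with kernel \<open>{(1, 1), (-1, -1)}\<close>.  The resulting bijective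
  homomorphism from the semidirect product is continuous on a compact space with values in a
  Hausdorff space, hence a homeomorphism.
\<close>

section \<open>The torus acting diagonally on the four complex lines\<close>

abbreviation torus :: "(complex \<times> complex) monoid" where
  "torus \<equiv> U1 \<times>\<times> U1"

text \<open>For \<open>u = (a, b)\<close> the weights are 1, ab, a b^-1, a^2, i.e. 1, p, q, pq. With
  \<open>cnj\<close> in place of the inverse, linearity and the composition law hold for arbitrary
  pairs, not only for unit ones.\<close>

definition rot :: "complex \<times> complex \<Rightarrow> cayley \<Rightarrow> cayley" where
  "rot u x = ((fst (fst x), fst u * snd u * snd (fst x)),
              (fst u * cnj (snd u) * fst (snd x), (fst u)\<^sup>2 * snd (snd x)))"

lemma carrier_torus: "carrier torus = {u. fst u * cnj (fst u) = 1 \<and> snd u * cnj (snd u) = 1}"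
  by (auto simp: U1_def)

declare carrier_DirProd [simp del]

lemma mult_cnj_eq_1_iff: "a * cnj a = 1 \<longleftrightarrow> cmod a = 1"
proof -
  have "a * cnj a = 1 \<longleftrightarrow> (cmod a)\<^sup>2 = 1"
    unfolding complex_norm_square[symmetric] of_real_eq_1_iff ..
  then show ?thesis
    using power2_eq_iff_nonneg[of "cmod a" 1] by simp
qed

lemma mult_torus: "u \<otimes>\<^bsub>torus\<^esub> v = (fst u * fst v, snd u * snd v)"
  by (cases u; cases v) (simp add: U1_def)

lemma linear_rot: "linear (rot u)"
  by (auto intro!: linearI simp: rot_def prod_eq_iff algebra_simps)

lemma rot_comp: "rot u \<circ> rot v = rot (fst u * fst v, snd u * snd v)"
  by (auto simp: rot_def fun_eq_iff algebra_simps power2_eq_square)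

lemma rot_one: "rot (1, 1) = id"
  by (auto simp: rot_def fun_eq_iff)

text \<open>Conjugation is multiplicative on each line, so moving \<open>gammaC\<close> past a
  rotation conjugates its parameters. This relation is the source of the semidirect action.\<close>

lemma rot_gammaC: "gammaC (rot u x) = rot (torus_act gammaC u) (gammaC x)"
  by (cases u) (simp add: rot_def gammaC_def qgammaC_def torus_act_def)

lemma rot_mult:
  assumes "u \<in> carrier torus"
  shows "rot u (x \<cdot>\<^sub>O y) = rot u x \<cdot>\<^sub>O rot u y"
proof -
  obtain a b where u: "u = (a, b)" by fastforce
  have a: "a * cnj a = 1" and b: "b * cnj b = 1"
    using assms by (auto simp: u carrier_torus)
  then have ab: "a \<noteq> 0" "b \<noteq> 0" "cnj a = inverse a" "cnj b = inverse b"
    by (auto simp: inverse_unique)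
  obtain x1 x2 x3 x4 where x: "x = ((x1, x2), (x3, x4))" by (metis surj_pair)
  obtain y1 y2 y3 y4 where y: "y = ((y1, y2), (y3, y4))" by (metis surj_pair)
  show ?thesis
    unfolding x y u rot_def cmult_def qmult_def qcnj_def prod_eq_iff
    \<comment> \<open>On unit parameters the conjugates become inverses, and the claim turns into an
      identity of rational expressions in a and b.\<close>
    by (simp add: ab(3,4)) (simp add: ab(1,2) field_simps power2_eq_square)
qed

section \<open>Automorphisms commuting with both involutions, and the kernel of the torus
  action\<close>

lemma G2_gamma_gammaH_iff:
  "\<alpha> \<in> carrier G2_gamma_gammaH \<longleftrightarrow>
    \<alpha> \<in> carrier G2 \<and> (\<forall>x. gamma (\<alpha> x) = \<alpha> (gamma x)) \<and> (\<forall>x. gammaH (\<alpha> x) = \<alpha> (gammaH x))"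
proof -
  have "\<sigma> \<circ> \<alpha> \<circ> \<sigma> = \<alpha> \<longleftrightarrow> (\<forall>x. \<sigma> (\<alpha> x) = \<alpha> (\<sigma> x))"
    if "\<sigma> \<circ> \<sigma> = id" for \<sigma> :: "cayley \<Rightarrow> cayley"
    using that unfolding fun_eq_iff comp_def id_def by metis
  then show ?thesis
    using involutions_square
    by (auto simp: G2_gamma_gammaH_def G2_fix_def simp del: split_paired_All)
qed

lemma mult_G2_gamma_gammaH [simp]: "\<alpha> \<otimes>\<^bsub>G2_gamma_gammaH\<^esub> \<beta> = \<alpha> \<circ> \<beta>"
  by (simp add: G2_gamma_gammaH_def G2_def)

lemma one_G2_gamma_gammaH [simp]: "\<one>\<^bsub>G2_gamma_gammaH\<^esub> = id"
  by (simp add: G2_gamma_gammaH_def G2_def)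

lemma gammaC_in: "gammaC \<in> carrier G2_gamma_gammaH"
  unfolding G2_gamma_gammaH_iff
  by (auto simp: involutions_in_G2 gamma_def gammaH_def gammaC_def qgammaH_def qgammaC_def)

lemma rot_in:
  assumes u: "u \<in> carrier torus"
  shows "rot u \<in> carrier G2_gamma_gammaH"
proof -
  \<comment> \<open>The conjugate parameters are the inverse in the torus, so they give a two-sided
    inverse.\<close>
  have "rot u \<circ> rot (cnj (fst u), cnj (snd u)) = id" "rot (cnj (fst u), cnj (snd u)) \<circ> rot u = id"
    using u by (simp_all add: carrier_torus rot_comp rot_one mult.commute)
  then have "bij (rot u)"
    by (metis o_bij)
  then have "rot u \<in> carrier G2"
    using rot_mult[OF u] linear_rot by (simp add: G2_def del: split_paired_All)
  then show ?thesis
    unfolding G2_gamma_gammaH_iff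
    by (auto simp: gamma_def gammaH_def qgammaH_def rot_def)
qed

lemma rot_group_hom: "group_hom torus G2_gamma_gammaH rot"
  by (intro group_hom.intro DirProd_group group_U1 group_G2_gamma_gammaH group_hom_axioms.intro homI
      rot_in) (simp_all only: mult_torus rot_comp mult_G2_gamma_gammaH)

lemma rot_eq_id_iff:
  assumes "u \<in> carrier torus"
  shows "rot u = id \<longleftrightarrow> u \<in> pmZ2"
proof
  obtain a b where u: "u = (a, b)" by fastforce
  assume "rot u = id"
  \<comment> \<open>The vector e_2 + e_2 e_4 displays the weights ab and a^2, which already
    determine the kernel.\<close>
  then have "rot u ((0, 1), (0, 1)) = ((0, 1), (0, 1))" by simp
  then have "a * b = 1" "a\<^sup>2 = 1" by (simp_all add: u rot_def)
  then have "a = 1 \<and> b = 1 \<or> a = - 1 \<and> b = - 1"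
    by (auto simp: power2_eq_1_iff minus_equation_iff[of b])
  then show "u \<in> pmZ2"
    by (auto simp: u pmZ2_def)
qed (auto simp: pmZ2_def rot_def fun_eq_iff)

lemma kernel_rot: "kernel torus G2_gamma_gammaH rot = pmZ2"
  using rot_eq_id_iff by (auto simp: kernel_def pmZ2_def carrier_torus)

section \<open>Every automorphism in the intersection is a rotation, possibly after
  \<open>gammaC\<close>\<close>

lemma G2_gamma_gammaH_cases:
  assumes "\<alpha> \<in> carrier G2_gamma_gammaH"
  obtains u k where "u \<in> carrier torus" "k \<in> {id, gammaC}" "\<alpha> = rot u \<circ> k"
proof -
  have lin: "linear \<alpha>" and bij: "bij \<alpha>" and mul: "\<And>x y. \<alpha> (x \<cdot>\<^sub>O y) = \<alpha> x \<cdot>\<^sub>O \<alpha> y"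
    and g: "\<And>x. gamma (\<alpha> x) = \<alpha> (gamma x)" and gH: "\<And>x. gammaH (\<alpha> x) = \<alpha> (gammaH x)"
    using assms by (auto simp: G2_gamma_gammaH_iff G2_def simp del: split_paired_All)
  note eigen = prod_eq_iff gamma_def gammaH_def qgammaH_def zero_prod_def
  define f where "f a = fst (fst (\<alpha> ((a, 0), 0)))" for a
  define p where "p = snd (fst (\<alpha> ((0, 1), 0)))"
  define q where "q = fst (snd (\<alpha> (0, (1, 0))))"
  \<comment> \<open>The image of a joint eigenvector has the same two signs, so each component on
    another line equals its own negative and vanishes.\<close>
  have A1: "\<alpha> ((a, 0), 0) = ((f a, 0), 0)" for a
    using g[of "((a, 0), 0)"] gH[of "((a, 0), 0)"]
    by (auto simp: f_def eigen)
  have A2: "\<alpha> ((0, 1), 0) = ((0, p), 0)"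
    using g[of "((0, 1), 0)"] gH[of "((0, 1), 0)"] linear_neg[OF lin, of "((0, 1), 0)"]
    by (auto simp: p_def eigen)
  have A3: "\<alpha> (0, (1, 0)) = (0, (q, 0))"
    using g[of "(0, (1, 0))"] gH[of "(0, (1, 0))"] linear_neg[OF lin, of "(0, (1, 0))"]
    by (auto simp: q_def eigen)
  note ops = cmult_def qmult_def qcnj_def zero_prod_def
  have f_mul: "f (a * b) = f a * f b" for a b
    using mul[of "((a, 0), 0)" "((b, 0), 0)"] A1 by (simp add: ops)
  have f_add: "f (a + b) = f a + f b" for a b
    using linear_add[OF lin, of "((a, 0), 0)" "((b, 0), 0)"] A1 by simp
  have f_scale: "f (r *\<^sub>R a) = r *\<^sub>R f a" for r a
    using linear_scale[OF lin, of r "((a, 0), 0)"] A1 by simp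
  have "f 1 \<noteq> 0"
  proof
    assume "f 1 = 0"
    then have "\<alpha> ((1, 0), 0) = \<alpha> 0"
      using A1[of 1] linear_0[OF lin] by (simp add: zero_prod_def)
    then show False
      using bij by (simp add: bij_is_inj inj_eq zero_prod_def)
  qed
  \<comment> \<open>\<open>f 1\<close> is a nonzero idempotent of a field.\<close>
  then have f1: "f 1 = 1"
    using f_mul[of 1 1] by simp
  have fm1: "f (- 1) = - 1"
    using f_scale[of "- 1" 1] f1 by simp
  have "f \<i> * f \<i> = - 1"
    using f_mul[of \<i> \<i>] fm1 by simp
  then have "(f \<i> - \<i>) * (f \<i> + \<i>) = 0"
    by (simp add: algebra_simps)
  then have fi: "f \<i> = \<i> \<or> f \<i> = - \<i>"
    by (auto simp: eq_neg_iff_add_eq_0)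
  have f_eq: "f z = Re z *\<^sub>R 1 + Im z *\<^sub>R f \<i>" for z
  proof -
    have "z = Re z *\<^sub>R 1 + Im z *\<^sub>R \<i>" by (simp add: complex_eq_iff)
    then show ?thesis by (metis f_add f_scale f1)
  qed
  have f_cases: "f = id \<or> f = cnj"
    using fi
  proof
    assume "f \<i> = \<i>"
    then have "f z = id z" for z
      using f_eq[of z] by (simp add: complex_eq_iff)
    then show ?thesis by blast
  next
    assume "f \<i> = - \<i>"
    then have "f z = cnj z" for z
      using f_eq[of z] by (simp add: complex_eq_iff)
    then show ?thesis by blast
  qed
  \<comment> \<open>The other lines are generated by products: b e_2, c e_4 and (d e_2) e_4. In the
    last product the coefficient of e_4 becomes the left factor, so q enters unconjugated.\<close>
  have "((b, 0), 0) \<cdot>\<^sub>O ((0, 1), 0) = ((0, b), 0)" for b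
    by (simp add: ops)
  then have B2: "\<alpha> ((0, b), 0) = ((0, p * f b), 0)" for b
    using mul[of "((b, 0), 0)" "((0, 1), 0)"] unfolding A1 A2 by (simp add: ops mult.commute)
  have "((c, 0), 0) \<cdot>\<^sub>O (0, (1, 0)) = (0, (c, 0))" for c
    by (simp add: ops)
  then have B3: "\<alpha> (0, (c, 0)) = (0, (q * f c, 0))" for c
    using mul[of "((c, 0), 0)" "(0, (1, 0))"] unfolding A1 A3 by (simp add: ops)
  have "((0, d), 0) \<cdot>\<^sub>O (0, (1, 0)) = (0, (0, d))" for d
    by (simp add: ops)
  then have B4: "\<alpha> (0, (0, d)) = (0, (0, p * q * f d))" for d
    using mul[of "((0, d), 0)" "(0, (1, 0))"] unfolding B2 A3 by (simp add: ops mult_ac)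
  have \<alpha>_eq: "\<alpha> ((a, b), (c, d)) = ((f a, p * f b), (q * f c, p * q * f d))" for a b c d
  proof -
    have "((a, b), (c, d)) = ((a, 0), 0) + ((0, b), 0) + (0, (c, 0)) + (0, (0, d))"
      by (simp add: zero_prod_def)
    then show ?thesis
      by (simp add: linear_add[OF lin] A1 B2 B3 B4 del: add_Pair) (simp add: zero_prod_def)
  qed
  have \<alpha>_m1: "\<alpha> ((- 1, 0), 0) = ((- 1, 0), 0)"
    using A1[of "- 1"] fm1 by simp
  \<comment> \<open>The squares of e_2 and e_4 are -1, and so are those of their images; this makes
    p and q unit numbers.\<close>
  have "((0, 1), 0) \<cdot>\<^sub>O ((0, 1), 0) = ((- 1, 0), 0)"
    by (simp add: ops)
  then have p: "p * cnj p = 1"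
    using mul[of "((0, 1), 0)" "((0, 1), 0)"] \<alpha>_m1 unfolding A2
    by (simp add: ops minus_equation_iff)
  have "(0, (1, 0)) \<cdot>\<^sub>O (0, (1, 0)) = ((- 1, 0), 0)"
    by (simp add: ops)
  then have q: "q * cnj q = 1"
    using mul[of "(0, (1, 0))" "(0, (1, 0))"] \<alpha>_m1 unfolding A3
    by (simp add: ops mult.commute)
  \<comment> \<open>Solving p = ab and q = a b^-1 gives a^2 = pq and b = p a^-1, where a^-1 is
    \<open>cnj a\<close> because a is a unit number. The other square root would change the sign of
    both a and b, which stays in the same coset of \<open>pmZ2\<close>.\<close>
  define a where "a = csqrt (p * q)"
  have a2: "a\<^sup>2 = p * q" by (simp add: a_def)
  have "cmod p = 1" "cmod q = 1"
    using p q by (simp_all only: mult_cnj_eq_1_iff)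
  have "(cmod a)\<^sup>2 = 1"
    using \<open>cmod p = 1\<close> \<open>cmod q = 1\<close> by (simp add: a2 norm_mult flip: norm_power)
  then have a: "a * cnj a = 1"
    using power2_eq_iff_nonneg[of "cmod a" 1] by (simp add: mult_cnj_eq_1_iff)
  define u where "u = (a, p * cnj a)"
  have rot_u: "rot u ((w, x), (y, z)) = ((w, p * x), (q * y, p * q * z))" for w x y z
  proof -
    have "a * (p * cnj a) = p * (a * cnj a)" by (simp only: mult_ac)
    moreover have "a * cnj (p * cnj a) = q * (p * cnj p)"
      using a2 by (simp add: power2_eq_square mult_ac)
    ultimately show ?thesis by (simp only: rot_def u_def a p a2 fst_conv snd_conv mult_1_right)
  qed
  have "\<exists>k\<in>{id, gammaC}. \<alpha> = rot u \<circ> k"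
    using f_cases
  proof
    assume "f = id"
    then have "\<alpha> = rot u \<circ> id" by (auto simp: fun_eq_iff \<alpha>_eq rot_u)
    then show ?thesis by blast
  next
    assume "f = cnj"
    then have "\<alpha> = rot u \<circ> gammaC"
      by (auto simp: fun_eq_iff \<alpha>_eq rot_u gammaC_def qgammaC_def)
    then show ?thesis by blast
  qed
  moreover have "u \<in> carrier torus"
    using \<open>cmod p = 1\<close> a by (simp add: carrier_torus u_def mult_cnj_eq_1_iff norm_mult)
  ultimately show ?thesis using that by blast
qed

section \<open>The isomorphism from the semidirect product\<close>

definition rot_quot :: "(complex \<times> complex) set \<Rightarrow> cayley \<Rightarrow> cayley" where
  "rot_quot A = the_elem (rot ` A)"

definition rot_semi :: "(complex \<times> complex) set \<times> (cayley \<Rightarrow> cayley) \<Rightarrow> cayley \<Rightarrow> cayley" where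
  "rot_semi = (\<lambda>(A, k). rot_quot A \<circ> k)"

text \<open>Every weight other than 1 is quadratic in the parameters, so a common sign cancels.
  Hence \<open>the_elem\<close> in \<open>rot_quot\<close> is applied to a singleton; this is the
  form of the induced map in the homomorphism theorem for \<open>FactGroup\<close>.\<close>

lemma rot_coset: "rot ` (pmZ2 #>\<^bsub>torus\<^esub> u) = {rot u}"
  by (auto simp: r_coset_def pmZ2_def mult_torus rot_def fun_eq_iff image_iff)

lemma rot_quot_coset: "rot_quot (pmZ2 #>\<^bsub>torus\<^esub> u) = rot u"
  by (simp add: rot_quot_def rot_coset)

lemma carrier_torus_quot: "carrier torus_quot = (\<lambda>u. pmZ2 #>\<^bsub>torus\<^esub> u) ` carrier torus"
  by (auto simp: torus_quot_def FactGroup_def RCOSETS_def)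

lemma rot_quot_hom: "rot_quot \<in> hom torus_quot G2_gamma_gammaH"
  using group_hom.FactGroup_hom[OF rot_group_hom]
  unfolding kernel_rot rot_quot_def torus_quot_def by simp

lemma rot_quot_inj: "inj_on rot_quot (carrier torus_quot)"
  using group_hom.FactGroup_inj_on[OF rot_group_hom]
  unfolding kernel_rot rot_quot_def torus_quot_def by simp

lemma torus_quot_act_coset:
  "torus_quot_act k (pmZ2 #>\<^bsub>torus\<^esub> u) = pmZ2 #>\<^bsub>torus\<^esub> torus_act k u"
  by (cases u) (simp add: torus_quot_act_def torus_act_def r_coset_def pmZ2_def mult_torus)

lemma torus_act_closed: "u \<in> carrier torus \<Longrightarrow> torus_act k u \<in> carrier torus"
  by (cases u) (auto simp: torus_act_def carrier_torus mult.commute)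

text \<open>This is the relation that matches composition of maps with the twisted multiplication of
  the semidirect product.\<close>

lemma rot_act:
  assumes "k \<in> {id, gammaC}"
  shows "k \<circ> rot u = rot (torus_act k u) \<circ> k"
proof (cases "k = gammaC")
  case False
  then show ?thesis using assms by (simp add: torus_act_def)
next
  case True
  then show ?thesis by (auto simp: comp_def rot_gammaC)
qed

lemma carrier_torus_semidirect:
  "carrier torus_semidirect = carrier torus_quot \<times> {id, gammaC}"
  by (simp add: torus_semidirect_def semidirect_def gammaC_group_def)

lemma rot_semi_hom: "rot_semi \<in> hom torus_semidirect G2_gamma_gammaH"
proof (rule homI)
  fix x assume "x \<in> carrier torus_semidirect"
  then obtain u k where x: "x = (pmZ2 #>\<^bsub>torus\<^esub> u, k)" "u \<in> carrier torus" "k \<in> {id, gammaC}"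
    by (auto simp: carrier_torus_semidirect carrier_torus_quot)
  interpret group G2_gamma_gammaH by (rule group_G2_gamma_gammaH)
  have "k \<in> carrier G2_gamma_gammaH" using x(3) gammaC_in one_closed by auto
  then show "rot_semi x \<in> carrier G2_gamma_gammaH"
    using m_closed[OF rot_in[OF x(2)]] by (simp add: x(1) rot_semi_def rot_quot_coset)
next
  fix x y assume "x \<in> carrier torus_semidirect" "y \<in> carrier torus_semidirect"
  then obtain u k v l where x: "x = (pmZ2 #>\<^bsub>torus\<^esub> u, k)" "u \<in> carrier torus" "k \<in> {id, gammaC}"
    and y: "y = (pmZ2 #>\<^bsub>torus\<^esub> v, l)" "v \<in> carrier torus" "l \<in> {id, gammaC}"
    by (auto simp: carrier_torus_semidirect carrier_torus_quot)
  let ?v = "torus_act k v"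
  have "rot_semi (x \<otimes>\<^bsub>torus_semidirect\<^esub> y) =
      rot_quot ((pmZ2 #>\<^bsub>torus\<^esub> u) \<otimes>\<^bsub>torus_quot\<^esub> (pmZ2 #>\<^bsub>torus\<^esub> ?v)) \<circ> (k \<circ> l)"
    by (simp add: x(1) y(1) torus_semidirect_def semidirect_def rot_semi_def torus_quot_act_coset
        gammaC_group_def G2_def)
  also have "\<dots> = rot u \<circ> rot ?v \<circ> (k \<circ> l)"
    using hom_mult[OF rot_quot_hom, of "pmZ2 #>\<^bsub>torus\<^esub> u" "pmZ2 #>\<^bsub>torus\<^esub> ?v"] x(2) y(2)
    by (simp add: carrier_torus_quot torus_act_closed rot_quot_coset)
  also have "\<dots> = rot u \<circ> k \<circ> (rot v \<circ> l)"
    using rot_act[OF x(3), of v] by (metis comp_assoc)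
  finally show "rot_semi (x \<otimes>\<^bsub>torus_semidirect\<^esub> y) =
      rot_semi x \<otimes>\<^bsub>G2_gamma_gammaH\<^esub> rot_semi y"
    by (simp add: x(1) y(1) rot_semi_def rot_quot_coset)
qed

lemma rot_semi_inj: "inj_on rot_semi (carrier torus_semidirect)"
proof (rule inj_onI)
  fix x y assume "x \<in> carrier torus_semidirect" "y \<in> carrier torus_semidirect"
    and eq: "rot_semi x = rot_semi y"
  then obtain u k v l where x: "x = (pmZ2 #>\<^bsub>torus\<^esub> u, k)" "u \<in> carrier torus" "k \<in> {id, gammaC}"
    and y: "y = (pmZ2 #>\<^bsub>torus\<^esub> v, l)" "v \<in> carrier torus" "l \<in> {id, gammaC}"
    by (auto simp: carrier_torus_semidirect carrier_torus_quot)
  have eq': "rot u \<circ> k = rot v \<circ> l"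
    using eq by (simp add: x(1) y(1) rot_semi_def rot_quot_coset)
  \<comment> \<open>Rotations fix the first line pointwise, so the value at e_1 is the imaginary
    unit for \<open>id\<close> and its negative for \<open>gammaC\<close>; it detects the second
    factor.\<close>
  then have "fst (fst (k ((\<i>, 0), 0))) = fst (fst (l ((\<i>, 0), 0)))"
    by (metis comp_apply fst_conv rot_def)
  then have "k = l"
    using x(3) y(3) by (auto simp: gammaC_def qgammaC_def)
  moreover have "k \<circ> k = id"
    using x(3) involutions_square by auto
  ultimately have "rot u = rot v"
    using eq' by (metis comp_assoc comp_id)
  then show "x = y"
    using inj_onD[OF rot_quot_inj, of "pmZ2 #>\<^bsub>torus\<^esub> u" "pmZ2 #>\<^bsub>torus\<^esub> v"] x y \<open>k = l\<close>
    by (simp add: rot_quot_coset carrier_torus_quot)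
qed

lemma rot_semi_image: "rot_semi ` carrier torus_semidirect = carrier G2_gamma_gammaH"
proof
  show "rot_semi ` carrier torus_semidirect \<subseteq> carrier G2_gamma_gammaH"
    using rot_semi_hom by (auto simp: hom_def)
  show "carrier G2_gamma_gammaH \<subseteq> rot_semi ` carrier torus_semidirect"
  proof
    fix \<alpha> assume "\<alpha> \<in> carrier G2_gamma_gammaH"
    then obtain u k where "u \<in> carrier torus" "k \<in> {id, gammaC}" "\<alpha> = rot u \<circ> k"
      by (rule G2_gamma_gammaH_cases)
    then have "(pmZ2 #>\<^bsub>torus\<^esub> u, k) \<in> carrier torus_semidirect" "\<alpha> = rot_semi (pmZ2 #>\<^bsub>torus\<^esub> u, k)"
      by (simp_all add: carrier_torus_semidirect carrier_torus_quot rot_semi_def rot_quot_coset)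
    then show "\<alpha> \<in> rot_semi ` carrier torus_semidirect" by blast
  qed
qed

lemma rot_semi_iso: "rot_semi \<in> iso torus_semidirect G2_gamma_gammaH"
  using rot_semi_hom rot_semi_inj rot_semi_image by (simp add: iso_def bij_betw_def)

section \<open>Continuity, compactness and the homeomorphism\<close>

lemma continuous_map_prod_discrete:
  assumes "\<And>d. d \<in> D \<Longrightarrow> continuous_map X Y (\<lambda>x. f (x, d))"
  shows "continuous_map (prod_topology X (discrete_topology D)) Y f"
  unfolding continuous_map
proof (intro conjI allI impI)
  show "f ` topspace (prod_topology X (discrete_topology D)) \<subseteq> topspace Y"
    using assms by (force simp: continuous_map_def)
next
  fix U assume U: "openin Y U"
  \<comment> \<open>The preimage splits into slices over the points of D, each a product of open
    sets since singletons are open.\<close>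
  have "{z \<in> topspace (prod_topology X (discrete_topology D)). f z \<in> U} =
      (\<Union>d\<in>D. {x \<in> topspace X. f (x, d) \<in> U} \<times> {d})"
    by auto
  moreover have "openin (prod_topology X (discrete_topology D))
      ({x \<in> topspace X. f (x, d) \<in> U} \<times> {d})" if "d \<in> D" for d
    using that openin_continuous_map_preimage[OF assms[OF that] U]
    by (simp add: openin_prod_Times_iff)
  ultimately show "openin (prod_topology X (discrete_topology D))
      {z \<in> topspace (prod_topology X (discrete_topology D)). f z \<in> U}"
    by auto
qed

lemma quotient_map_torus:
  "quotient_map (top_of_set (carrier torus)) torus_quot_topology (\<lambda>u. pmZ2 #>\<^bsub>torus\<^esub> u)"
  unfolding torus_quot_topology_def by (rule quotient_map_quotient_topology)

lemma rot_semi_continuous: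
  "continuous_map torus_semidirect_topology euclidean rot_semi"
  unfolding torus_semidirect_topology_def
proof (rule continuous_map_prod_discrete)
  fix k assume "k \<in> carrier gammaC_group"
  \<comment> \<open>Continuity into a product topology is tested at each argument x, where the value
    is polynomial in the parameters and their conjugates. Afterwards the map descends along the
    quotient map.\<close>
  have "continuous_on (carrier torus) (\<lambda>u. rot u (k x))" for x
    unfolding rot_def by (intro continuous_intros)
  then have "continuous_on (carrier torus) (\<lambda>u. rot u \<circ> k)"
    by (intro continuous_on_coordinatewise_then_product) simp
  then have "continuous_map (top_of_set (carrier torus)) euclidean
      ((\<lambda>A. rot_semi (A, k)) \<circ> (\<lambda>u. pmZ2 #>\<^bsub>torus\<^esub> u))"
    by (simp add: rot_semi_def rot_quot_coset comp_def)
  then show "continuous_map torus_quot_topology euclidean (\<lambda>A. rot_semi (A, k))"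
    using continuous_compose_quotient_map_eq[OF quotient_map_torus] by blast
qed

lemma compact_torus: "compact (carrier torus)"
proof -
  have "carrier torus = sphere 0 1 \<times> sphere 0 1"
    by (auto simp: carrier_torus mult_cnj_eq_1_iff)
  then show ?thesis by (simp add: compact_Times)
qed

text \<open>The first factor is a continuous image of the compact torus, and the second is finite
  and discrete.\<close>

lemma compact_torus_semidirect: "compact_space torus_semidirect_topology"
proof -
  have "compact_space torus_quot_topology"
    using image_compactin[OF _ quotient_imp_continuous_map[OF quotient_map_torus], of "carrier torus"]
      compact_torus quotient_imp_surjective_map[OF quotient_map_torus]
    by (simp add: compact_space_def compactin_subtopology)
  then show ?thesis
    by (simp add: torus_semidirect_topology_def compact_space_prod_topology
        compact_space_discrete_topology gammaC_group_def)
qed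

lemma topspace_G2_gamma_gammaH_topology:
  "topspace G2_gamma_gammaH_topology = carrier G2_gamma_gammaH"
  by (simp add: G2_gamma_gammaH_topology_def)

lemma rot_semi_homeomorphic:
  "homeomorphic_map torus_semidirect_topology G2_gamma_gammaH_topology rot_semi"
proof (rule continuous_imp_homeomorphic_map)
  show "Hausdorff_space G2_gamma_gammaH_topology"
    unfolding G2_gamma_gammaH_topology_def
    by (intro Hausdorff_space_subtopology)
       (metis Hausdorff_space_euclidean Hausdorff_space_product_topology euclidean_product_topology)
  show "continuous_map torus_semidirect_topology G2_gamma_gammaH_topology rot_semi"
    unfolding G2_gamma_gammaH_topology_def continuous_map_in_subtopology
    using rot_semi_continuous rot_semi_image by (auto simp: topspace_torus_semidirect_topology)
qed (simp_all add: compact_torus_semidirect topspace_torus_semidirect_topology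
    topspace_G2_gamma_gammaH_topology rot_semi_image rot_semi_inj)

theorem theorem4p1p5:
  shows "\<exists>\<phi> \<in> iso G2_gamma_gammaH torus_semidirect.
    homeomorphic_map G2_gamma_gammaH_topology torus_semidirect_topology \<phi>"
proof
  let ?\<phi> = "inv_into (carrier torus_semidirect) rot_semi"
  show "?\<phi> \<in> iso G2_gamma_gammaH torus_semidirect"
    by (rule group.iso_set_sym[OF group_torus_semidirect rot_semi_iso])
  obtain g where g: "homeomorphic_maps torus_semidirect_topology G2_gamma_gammaH_topology rot_semi g"
    using rot_semi_homeomorphic by (auto simp: homeomorphic_map_maps)
  \<comment> \<open>The continuous inverse \<open>g\<close> and the algebraic inverse
    \<open>?\<phi>\<close> are chosen separately; injectivity of \<open>rot_semi\<close> makes them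
    agree on the whole group.\<close>
  have "g \<alpha> = ?\<phi> \<alpha>" if "\<alpha> \<in> topspace G2_gamma_gammaH_topology" for \<alpha>
  proof -
    have "g \<alpha> \<in> carrier torus_semidirect" "rot_semi (g \<alpha>) = \<alpha>"
      using g that
      by (auto simp: homeomorphic_maps_def continuous_map_def topspace_torus_semidirect_topology)
    then show ?thesis
      using inv_into_f_f[OF rot_semi_inj] by metis
  qed
  moreover have "homeomorphic_map G2_gamma_gammaH_topology torus_semidirect_topology g"
    using g by (simp add: homeomorphic_maps_map)
  ultimately show "homeomorphic_map G2_gamma_gammaH_topology torus_semidirect_topology ?\<phi>"
    by (rule homeomorphic_map_eq[rotated])
qed

end
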